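(* In the setting described in the context (the Laurent polynomial ring $S=k[x_1,\ldots,x_r,x_{r+1}^{\pm1},\ldots,x_n^{\pm1}]$ multigraded by the finitely generated abelian group $A$ through the matrix $L$), the following statements are equivalent: (1) There exists $a\in A$ such that the $k$-vector space $S_a$ is finite dimensional. (2) For all $a\in A$, the $k$-vector space $S_a$ is finite dimensional. (3) Any fan compatible with the multigrading of $S$ by $A$ is not contained in a half-space.
   Context: $k$ is an algebraically closed field of characteristic $0$, $n=r+s$, $X=k^r\times(k^{\times})^s$, $S=k[x_1,\ldots,x_r,x_{r+1}^{\pm1},\ldots,x_n^{\pm1}]$. $H=(k^\times)^p\times\mathbb{F}$ with $\mathbb{F}$ a product of cyclic groups of orders $d_1,\ldots,d_t$; $m=p+t$; the character group $A=\mathrm{Hom}(H,k^\times)$ is identified with $\mathbb{Z}^p\oplus\mathbb{Z}/d_1\mathbb{Z}\oplus\cdots\oplus\mathbb{Z}/d_t\mathbb{Z}$. $H$ acts diagonally and faithfully on $X$ with weights $\eta_1,\ldots,\eta_n\in A$ ($h$ multiplies the $i$-th coordinate by $\eta_i(h)$), and $L$ is the $m\times n$ integer matrix whose $i$-th column represents $\eta_i$. The degree map is $\deg:\mathbb{Z}^n\to A$, $\deg(\lambda)=L\lambda$ (read in $A$), i.e. $\deg(\lambda)=\sum\lambda_i\eta_i$. For $a\in A$, $S_a=\mathrm{span}_k\{x^\lambda\in S\mid L\lambda=a\}$. Put $l=n-p$. The kernel $\mathfrak{K}$ of $\deg$ is free of rank $l$; fix an $n\times l$ integer matrix $K$ whose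 columns form a $\mathbb{Z}$-basis of $\mathfrak{K}$, and let $v_1,\ldots,v_r\in N=\mathbb{Z}^l$ be its first $r$ rows. $M=\mathrm{Hom}(N,\mathbb{Z})$, with natural pairing $\langle\cdot,\cdot\rangle$; $N_{\mathbb{R}},M_{\mathbb{R}}$ are the scalar extensions to $\mathbb{R}$. A fan in $N$ is a finite collection of strongly convex rational polyhedral cones in $N_{\mathbb{R}}$, closed under faces and meeting in common faces. A fan is compatible with the multigrading of $S$ by $A$ if its set of one-dimensional cones equals $\{\mathbb{R}_{\ge0}v_i\mid i=1,\ldots,r\}$. A fan $\Delta$ is contained in a half-space if there is $0\ne u\in M_{\mathbb{R}}$ with $\langle u,v\rangle\ge0$ for all $v\in\sigma$ and all $\sigma\in\Delta$.
   Formalization: In (1) the space S_a is required to be nonzero (for weights 1,1,0 one has S_{-1}=0 but S_0=k[x_3]), and in "compatible" a zero vector v_i contributes no one-dimensional cone (otherwise no fan would be compatible and (3) would hold vacuously). *)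

theory Defs
  imports
    "HOL-Algebra.Algebra"
    "HOL-Library.Poly_Mapping"
    "Jordan_Normal_Form.DL_Rank"
begin

section \<open>The group H, its character group A, and the diagonal action\<close>

definition unit_group :: "'k::field monoid" where
  "unit_group = \<lparr>carrier = - {0}, monoid.mult = (*), one = 1\<rparr>"

text \<open>The cyclic group of order \<open>d\<close> is realised inside \<open>k\<close>: over an algebraically closed field of
  characteristic 0 the \<open>d\<close>-th roots of unity form a cyclic group of order \<open>d\<close>.  With this model the
  residue class of \<open>b\<close> in \<open>\<int>/d\<int>\<close> is the character \<open>z \<mapsto> z\<^sup>b\<close>, so the identification of the
  (algebraic) characters of \<open>H\<close> with tuples of integers and residues involves no choice.\<close>

definition root_group :: "nat \<Rightarrow> 'k::field monoid" where
  "root_group d = \<lparr>carrier = {z. z ^ d = 1}, monoid.mult = (*), one = 1\<rparr>"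

definition diag_group :: "nat \<Rightarrow> nat \<Rightarrow> (nat \<Rightarrow> nat) \<Rightarrow> (nat \<Rightarrow> 'k::field) monoid" where
  "diag_group p t d =
     product_group {..<p + t} (\<lambda>j. if j < p then unit_group else root_group (d (j - p)))"

definition char_group :: "nat \<Rightarrow> nat \<Rightarrow> (nat \<Rightarrow> nat) \<Rightarrow> (nat \<Rightarrow> int) monoid" where
  "char_group p t d =
     product_group {..<p + t} (\<lambda>j. if j < p then integer_group else integer_mod_group (d (j - p)))"

text \<open>\<open>weight L i\<close> is the character \<open>\<eta>\<^sub>i\<close> represented by the \<open>i\<close>-th column of \<open>L\<close> (columns, rows and
  coordinates are numbered from 0).\<close>

definition weight :: "int mat \<Rightarrow> nat \<Rightarrow> (nat \<Rightarrow> 'k::field) \<Rightarrow> 'k" where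
  "weight L i h = (\<Prod>j<dim_row L. h j powi (L $$ (j, i)))"

definition affine_torus_space :: "nat \<Rightarrow> nat \<Rightarrow> 'k::field vec set" where
  "affine_torus_space r s = {x \<in> carrier_vec (r + s). \<forall>i. r \<le> i \<and> i < r + s \<longrightarrow> x $ i \<noteq> 0}"

definition diag_action :: "nat \<Rightarrow> nat \<Rightarrow> int mat \<Rightarrow> (nat \<Rightarrow> 'k::field) \<Rightarrow> 'k vec \<Rightarrow> 'k vec" where
  "diag_action r s L h =
     (\<lambda>x\<in>affine_torus_space r s. vec (r + s) (\<lambda>i. weight L i h * x $ i))"

definition deg :: "nat \<Rightarrow> nat \<Rightarrow> (nat \<Rightarrow> nat) \<Rightarrow> int mat \<Rightarrow> int vec \<Rightarrow> (nat \<Rightarrow> int)" where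
  "deg p t d L \<nu> =
     (\<lambda>j\<in>{..<p + t}. if j < p then (L *\<^sub>v \<nu>) $ j else (L *\<^sub>v \<nu>) $ j mod int (d (j - p)))"

definition deg_kernel :: "nat \<Rightarrow> nat \<Rightarrow> nat \<Rightarrow> (nat \<Rightarrow> nat) \<Rightarrow> int mat \<Rightarrow> int vec set" where
  "deg_kernel n p t d L = {\<nu> \<in> carrier_vec n. deg p t d L \<nu> = \<one>\<^bsub>char_group p t d\<^esub>}"

definition columns_form_basis :: "int mat \<Rightarrow> int vec set \<Rightarrow> bool" where
  "columns_form_basis K \<Lambda> \<longleftrightarrow>
     set (cols K) \<subseteq> \<Lambda> \<and> (\<forall>\<nu>\<in>\<Lambda>. \<exists>!c. c \<in> carrier_vec (dim_col K) \<and> K *\<^sub>v c = \<nu>)"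


section \<open>The multigraded Laurent polynomial ring\<close>

type_synonym 'k laurent = "(nat \<Rightarrow>\<^sub>0 int) \<Rightarrow>\<^sub>0 'k"

text \<open>\<open>'k laurent\<close> is the ring of Laurent polynomials over \<open>'k\<close> in the variables
  \<open>x\<^sub>0, x\<^sub>1, \<dots>\<close>, all inverted.\<close>

definition mixed_laurent_ring :: "nat \<Rightarrow> nat \<Rightarrow> 'k::field laurent set" where
  "mixed_laurent_ring r s =
     {f. \<forall>e\<in>Poly_Mapping.keys f. Poly_Mapping.keys e \<subseteq> {..<r + s} \<and> (\<forall>i<r. 0 \<le> Poly_Mapping.lookup e i)}"

definition laurent_monom :: "int vec \<Rightarrow> 'k::field laurent" where
  "laurent_monom \<nu> = Poly_Mapping.single (\<Sum>i<dim_vec \<nu>. Poly_Mapping.single i (\<nu> $ i)) 1"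

abbreviation scalar_mult :: "'k::field \<Rightarrow> 'k laurent \<Rightarrow> 'k laurent" where
  "scalar_mult c f \<equiv> Poly_Mapping.map ((*) c) f"

text \<open>A graded part can be 0, and a single vanishing graded part says nothing about the others: if
  \<open>k\<^sup>\<times>\<close> acts on \<open>k\<^sup>2\<close> with weights 1 and 0, then the part of degree \<open>-1\<close> is 0 while the part of
  degree 0 is \<open>k[x\<^sub>1]\<close>.  The existence of a finite-dimensional graded part is therefore meaningful only
  for nonzero graded parts.\<close>

definition graded_part ::
    "nat \<Rightarrow> nat \<Rightarrow> nat \<Rightarrow> nat \<Rightarrow> (nat \<Rightarrow> nat) \<Rightarrow> int mat \<Rightarrow> (nat \<Rightarrow> int)
      \<Rightarrow> 'k::field laurent set" where
  "graded_part r s p t d L a =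
     Modules.module.span scalar_mult
       {laurent_monom \<nu> | \<nu>. \<nu> \<in> carrier_vec (r + s) \<and>
          (laurent_monom \<nu> :: 'k laurent) \<in> mixed_laurent_ring r s \<and> deg p t d L \<nu> = a}"

definition finite_dimensional :: "'k::field laurent set \<Rightarrow> bool" where
  "finite_dimensional V \<longleftrightarrow> (\<exists>B. finite B \<and> V = Modules.module.span scalar_mult B)"


section \<open>Fans\<close>

text \<open>\<open>N\<^sub>\<real>\<close> and \<open>M\<^sub>\<real>\<close> are both \<open>carrier_vec l\<close>, and the pairing is the scalar product.  The columns of \<open>G\<close>
  below are generators of the cone (none at all for the zero cone).\<close>

definition rational_polyhedral_cone :: "nat \<Rightarrow> real vec set \<Rightarrow> bool" where
  "rational_polyhedral_cone l \<sigma> \<longleftrightarrow>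
     (\<exists>q. \<exists>G :: int mat. G \<in> carrier_mat l q \<and>
        \<sigma> = {map_mat real_of_int G *\<^sub>v c | c. c \<in> carrier_vec q \<and> (\<forall>j<q. 0 \<le> c $ j)})"

definition strongly_convex :: "nat \<Rightarrow> real vec set \<Rightarrow> bool" where
  "strongly_convex l \<sigma> \<longleftrightarrow> \<sigma> \<inter> uminus ` \<sigma> = {0\<^sub>v l}"

definition cone_face :: "nat \<Rightarrow> real vec set \<Rightarrow> real vec set \<Rightarrow> bool" where
  "cone_face l \<tau> \<sigma> \<longleftrightarrow>
     (\<exists>u\<in>carrier_vec l. (\<forall>v\<in>\<sigma>. 0 \<le> u \<bullet> v) \<and> \<tau> = {v \<in> \<sigma>. u \<bullet> v = 0})"

definition fan :: "nat \<Rightarrow> real vec set set \<Rightarrow> bool" where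
  "fan l \<Delta> \<longleftrightarrow>
     finite \<Delta> \<and>
     (\<forall>\<sigma>\<in>\<Delta>. rational_polyhedral_cone l \<sigma> \<and> strongly_convex l \<sigma>) \<and>
     (\<forall>\<sigma>\<in>\<Delta>. \<forall>\<tau>. cone_face l \<tau> \<sigma> \<longrightarrow> \<tau> \<in> \<Delta>) \<and>
     (\<forall>\<sigma>\<in>\<Delta>. \<forall>\<sigma>'\<in>\<Delta>. cone_face l (\<sigma> \<inter> \<sigma>') \<sigma> \<and> cone_face l (\<sigma> \<inter> \<sigma>') \<sigma>')"

definition cone_dim :: "nat \<Rightarrow> real vec set \<Rightarrow> nat" where
  "cone_dim l \<sigma> =
     vectorspace.dim class_ring (LinearCombinations.module.span_vs class_ring (module_vec TYPE(real) l) \<sigma>)"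

definition ray :: "real vec \<Rightarrow> real vec set" where
  "ray v = {c \<cdot>\<^sub>v v | c. 0 \<le> c}"

text \<open>\<open>v\<^sub>i\<close> is the \<open>i\<close>-th row of \<open>K\<close>.  A zero row spans no one-dimensional cone and so contributes none:
  the zero cone is removed from the right-hand side.  (Otherwise no fan at all would be compatible as
  soon as some \<open>v\<^sub>i\<close> is 0.)\<close>

definition compatible_fan :: "nat \<Rightarrow> nat \<Rightarrow> int mat \<Rightarrow> real vec set set \<Rightarrow> bool" where
  "compatible_fan r l K \<Delta> \<longleftrightarrow>
     {\<sigma> \<in> \<Delta>. cone_dim l \<sigma> = 1} = {ray (map_vec real_of_int (row K i)) | i. i < r} - {{0\<^sub>v l}}"

definition contained_in_half_space :: "nat \<Rightarrow> real vec set set \<Rightarrow> bool" where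
  "contained_in_half_space l \<Delta> \<longleftrightarrow>
     (\<exists>u\<in>carrier_vec l. u \<noteq> 0\<^sub>v l \<and> (\<forall>\<sigma>\<in>\<Delta>. \<forall>v\<in>\<sigma>. 0 \<le> u \<bullet> v))"

end

theory Submission
  imports Defs
begin

text \<open>The exponents of degree \<open>a\<close> form the solutions \<open>\<nu>\<close> of \<open>deg \<nu> = a\<close> whose first \<open>r\<close> entries are
  nonnegative, and the corresponding monomials are a basis of the graded part \<open>S\<^sub>a\<close>.  All three
  conditions of the theorem say that there is no obstruction of one fixed kind, independent of \<open>a\<close>:
  a nonzero vector \<open>\<mu>\<close> in the kernel of \<open>deg\<close> whose first \<open>r\<close> entries are nonnegative.

  Such a \<open>\<mu>\<close> makes every nonzero \<open>S\<^sub>a\<close> infinite dimensional, because \<open>\<nu> + k \<mu>\<close> is an exponent of degree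
  \<open>a\<close> for all \<open>k\<close> as soon as \<open>\<nu>\<close> is one (\<open>kernel_vector_imp_infinite_exponents\<close>); and \<open>S\<^sub>0\<close> is never
  zero, as it contains the constants.  Conversely, among infinitely many exponents of the same degree
  Dickson's lemma finds two different ones that are comparable in the first \<open>r\<close> entries, and their
  difference is such a \<open>\<mu>\<close> (\<open>infinite_exponents_imp_kernel_vector\<close>).

  In the coordinates given by \<open>K\<close> the obstruction is a nonzero integral \<open>c\<close> with
  \<open>\<langle>v\<^sub>i, c\<rangle> \<ge> 0\<close> for all \<open>i < r\<close>, that is, an integral half-space containing all the rays.  If there is one,
  then the fan consisting only of the zero cone and the rays through the \<open>v\<^sub>i\<close> is compatible and lies in
  this half-space.  Conversely, a compatible fan in a real half-space \<open>u\<close> forces \<open>\<langle>v\<^sub>i, u\<rangle> \<ge> 0\<close>, and what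
  remains is to replace \<open>u\<close> by an integral vector.  Rounding a multiple of \<open>u\<close> may violate those
  inequalities that hold with equality, so rounding is applied only after the rational linear relations
  between the entries of \<open>u\<close> have been used to eliminate variables
  (\<open>real_vector_signs_realised_by_int_vector\<close>).\<close>

section \<open>Dickson's lemma\<close>

text \<open>Every sequence in a linear order has a monotone subsequence.  A decreasing one that is bounded below in
  the integers is constant from the point where it attains its minimum, hence increasing after a shift.\<close>

lemma nonneg_int_seq_has_incseq_subseq:
  fixes x :: "nat \<Rightarrow> int"
  assumes "\<And>j. 0 \<le> x j"
  shows "\<exists>g. strict_mono (g :: nat \<Rightarrow> nat) \<and> incseq (x \<circ> g)"
proof -
  obtain g where g: "strict_mono (g :: nat \<Rightarrow> nat)" and mono: "monoseq (\<lambda>j. x (g j))"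
    using seq_monosub by blast
  show ?thesis
  proof (cases "incseq (x \<circ> g)")
    case False
    then have dec: "x (g j) \<le> x (g i)" if "i \<le> j" for i j
      using mono that by (auto simp: monoseq_iff incseq_def decseq_def)
    obtain N where N: "\<And>j. nat (x (g N)) \<le> nat (x (g j))"
      using ex_has_least_nat[of "\<lambda>_. True" 0 "\<lambda>j. nat (x (g j))"] by auto
    have const: "x (g (N + j)) = x (g N)" for j
      using N[of "N + j"] dec[of N "N + j"] assms[of "g N"] assms[of "g (N + j)"] by simp
    have "strict_mono (\<lambda>j. g (N + j))"
      using g by (simp add: strict_mono_def)
    moreover have "incseq (x \<circ> (\<lambda>j. g (N + j)))"
      by (simp add: incseq_def const)
    ultimately show ?thesis by blast
  qed (use g in blast)
qed

lemma nonneg_int_seqs_have_common_incseq_subseq: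
  fixes x :: "nat \<Rightarrow> nat \<Rightarrow> int"
  assumes "\<And>i j. i < r \<Longrightarrow> 0 \<le> x i j"
  shows "\<exists>g. strict_mono (g :: nat \<Rightarrow> nat) \<and> (\<forall>i<r. incseq (x i \<circ> g))"
  using assms
proof (induction r)
  case 0
  then show ?case using strict_mono_id by auto
next
  case (Suc r)
  then obtain g where g: "strict_mono (g :: nat \<Rightarrow> nat)" "\<And>i. i < r \<Longrightarrow> incseq (x i \<circ> g)"
    by (metis less_SucI)
  obtain h where h: "strict_mono (h :: nat \<Rightarrow> nat)" "incseq ((x r \<circ> g) \<circ> h)"
    using nonneg_int_seq_has_incseq_subseq[of "x r \<circ> g"] Suc.prems by auto
  have "incseq (x i \<circ> (g \<circ> h))" if "i < Suc r" for i
  proof (cases "i = r")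
    case True
    then show ?thesis using h(2) by (simp add: o_assoc)
  next
    case False
    then have "incseq (x i \<circ> g)" using that g(2) by simp
    then show ?thesis using h(1) by (simp add: incseq_def strict_mono_less_eq)
  qed
  moreover have "strict_mono (g \<circ> h)"
    using g(1) h(1) by (rule strict_mono_o)
  ultimately show ?case by blast
qed

text \<open>Only the first \<open>r\<close> entries are constrained; the others, belonging to inverted variables, may be
  arbitrary, so the two vectors found here can agree in all of their first \<open>r\<close> entries.\<close>

lemma infinite_exponent_set_has_comparable_pair:
  fixes E :: "int vec set"
  assumes "infinite E" "\<And>\<nu> i. \<nu> \<in> E \<Longrightarrow> i < r \<Longrightarrow> 0 \<le> \<nu> $ i"
  shows "\<exists>\<nu>\<in>E. \<exists>\<nu>'\<in>E. \<nu> \<noteq> \<nu>' \<and> (\<forall>i<r. \<nu> $ i \<le> \<nu>' $ i)"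
proof -
  obtain f :: "nat \<Rightarrow> int vec" where f: "inj f" "range f \<subseteq> E"
    using infinite_countable_subset[OF assms(1)] by blast
  then have "0 \<le> f j $ i" if "i < r" for i j
    using assms(2) that by blast
  then obtain g where g: "strict_mono (g :: nat \<Rightarrow> nat)" "\<And>i. i < r \<Longrightarrow> incseq ((\<lambda>j. f j $ i) \<circ> g)"
    using nonneg_int_seqs_have_common_incseq_subseq[of r "\<lambda>i j. f j $ i"] by auto
  have "f (g 0) \<noteq> f (g 1)"
    using f(1) g(1) by (metis inj_eq strict_mono_eq zero_neq_one)
  moreover have "f (g 0) $ i \<le> f (g 1) $ i" if "i < r" for i
    using g(2)[OF that] by (simp add: incseq_def)
  ultimately show ?thesis using f(2) by blast
qed

section \<open>Integral vectors in real half-spaces\<close>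

text \<open>If the entries of \<open>u\<close> are linearly independent over the rationals, then every form \<open>v\<close> that does
  not vanish identically has a nonzero value at \<open>u\<close>, and rounding a large multiple of \<open>u\<close> changes no
  sign.  A relation with integer coefficients \<open>a\<close> and \<open>a k \<noteq> 0\<close> expresses \<open>u k\<close> by the other entries;
  substituting this in the forms, with denominators cleared, leaves a problem with one variable fewer.\<close>

lemma real_vector_signs_realised_by_int_vector:
  fixes u :: "'i \<Rightarrow> real" and V :: "('i \<Rightarrow> int) set"
  assumes "finite I" "finite V"
  shows "\<exists>c :: 'i \<Rightarrow> int. \<forall>v\<in>V. sgn (\<Sum>i\<in>I. real_of_int (v i) * real_of_int (c i))
                          = sgn (\<Sum>i\<in>I. real_of_int (v i) * u i)"
  using assms
proof (induction "card I" arbitrary: I V)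
  case 0
  then show ?case by simp
next
  case (Suc m)
  show ?case
  proof (cases "\<exists>a :: 'i \<Rightarrow> int. (\<exists>k\<in>I. a k \<noteq> 0) \<and> (\<Sum>i\<in>I. real_of_int (a i) * u i) = 0")
    case True
    then obtain a :: "'i \<Rightarrow> int" and k where k: "k \<in> I" "a k \<noteq> 0"
      and rel: "(\<Sum>i\<in>I. real_of_int (a i) * u i) = 0" by blast
    define J where "J = I - {k}"
    \<comment> \<open>\<open>red v\<close> is the form obtained from \<open>v\<close> by the substitution, multiplied by \<open>(a k)\<^sup>2\<close> rather
      than \<open>a k\<close> so that the sign of \<open>a k\<close> does not matter.\<close>
    define red where "red v i = (a k)\<^sup>2 * v i - a k * v k * a i" for v i
    have fin: "finite J" "k \<notin> J" "I = insert k J"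
      using Suc.prems k by (auto simp: J_def)
    have "m = card J" using Suc.hyps(2) fin by simp
    from Suc.hyps(1)[OF this fin(1), of "red ` V"] Suc.prems
    obtain c :: "'i \<Rightarrow> int" where c: "\<And>v. v \<in> V \<Longrightarrow>
        sgn (\<Sum>i\<in>J. real_of_int (red v i) * real_of_int (c i)) = sgn (\<Sum>i\<in>J. real_of_int (red v i) * u i)"
      by auto
    have elim: "(\<Sum>i\<in>J. real_of_int (red v i) * w i) = (real_of_int (a k))\<^sup>2 * (\<Sum>i\<in>I. real_of_int (v i) * w i)"
      if "(\<Sum>i\<in>I. real_of_int (a i) * w i) = 0" for v and w :: "'i \<Rightarrow> real"
    proof -
      have "(\<Sum>i\<in>J. real_of_int (red v i) * w i) =
          (real_of_int (a k))\<^sup>2 * (\<Sum>i\<in>J. real_of_int (v i) * w i)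
          - real_of_int (a k) * real_of_int (v k) * (\<Sum>i\<in>J. real_of_int (a i) * w i)"
        by (simp add: red_def sum_distrib_left algebra_simps sum_subtractf)
      moreover have "(\<Sum>i\<in>J. real_of_int (a i) * w i) = - (real_of_int (a k) * w k)"
        using that fin by simp
      ultimately show ?thesis
        using fin by (simp add: algebra_simps power2_eq_square)
    qed
    \<comment> \<open>The solution for the other variables is scaled by \<open>(a k)\<^sup>2\<close>: a positive factor leaves the signs
      alone, and its divisibility by \<open>a k\<close> makes the entry \<open>k\<close> dictated by the relation \<open>a\<close> integral.\<close>
    define c' where "c' i = (if i = k then - a k * (\<Sum>j\<in>J. a j * c j) else (a k)\<^sup>2 * c i)" for i
    have c'J: "(\<Sum>i\<in>J. real_of_int (w i) * real_of_int (c' i)) =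
        (real_of_int (a k))\<^sup>2 * (\<Sum>i\<in>J. real_of_int (w i) * real_of_int (c i))" for w
      unfolding sum_distrib_left
      by (rule sum.cong) (use fin in \<open>auto simp: c'_def\<close>)
    have rel': "(\<Sum>i\<in>I. real_of_int (a i) * real_of_int (c' i)) = 0"
      using fin c'J[of a] by (simp add: c'_def power2_eq_square)
    have pos: "0 < (real_of_int (a k))\<^sup>2" using k by simp
    have "sgn (\<Sum>i\<in>I. real_of_int (v i) * real_of_int (c' i)) = sgn (\<Sum>i\<in>I. real_of_int (v i) * u i)"
      if "v \<in> V" for v
      using c[OF that] elim[OF rel, of v] elim[OF rel', of v] c'J[of "red v"] pos
      by (metis mult_1 sgn_mult sgn_pos)
    then show ?thesis by blast
  next
    case indep: False
    define B where "B v = (\<Sum>i\<in>I. \<bar>real_of_int (v i)\<bar>)" for v :: "'i \<Rightarrow> int"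
    define D where "D v = (\<Sum>i\<in>I. real_of_int (v i) * u i)" for v :: "'i \<Rightarrow> int"
    \<comment> \<open>Rounding \<open>N u\<close> moves the value of \<open>v\<close> by at most \<open>B v\<close>, while \<open>N D v\<close> must be farther than that
      from 0.  For \<open>D v = 0\<close> the summand is \<open>B v / 0 = 0\<close> and imposes nothing.\<close>
    define N where "N = 1 + (\<Sum>v\<in>V. B v / \<bar>D v\<bar>)"
    have Bnn: "0 \<le> B v" for v by (simp add: B_def sum_nonneg)
    have Nnn: "0 < N" using Bnn by (simp add: N_def sum_nonneg add_pos_nonneg)
    define c where "c i = \<lfloor>N * u i\<rfloor>" for i
    have "sgn (\<Sum>i\<in>I. real_of_int (v i) * real_of_int (c i)) = sgn (D v)" if v: "v \<in> V" for v
    proof (cases "D v = 0")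
      case True
      then have "v i = 0" if "i \<in> I" for i
        using indep that by (auto simp: D_def)
      then show ?thesis by (simp add: D_def)
    next
      case False
      have "\<bar>(\<Sum>i\<in>I. real_of_int (v i) * real_of_int (c i)) - N * D v\<bar>
          = \<bar>\<Sum>i\<in>I. real_of_int (v i) * (real_of_int (c i) - N * u i)\<bar>"
        by (simp add: D_def sum_distrib_left sum_subtractf algebra_simps)
      also have "\<dots> \<le> (\<Sum>i\<in>I. \<bar>real_of_int (v i) * (real_of_int (c i) - N * u i)\<bar>)"
        by (rule sum_abs)
      also have "\<dots> \<le> B v"
        unfolding B_def abs_mult
        by (intro sum_mono mult_left_le) (auto simp: c_def abs_le_iff, linarith+)
      finally have close: "\<bar>(\<Sum>i\<in>I. real_of_int (v i) * real_of_int (c i)) - N * D v\<bar> \<le> B v" .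
      have "B v / \<bar>D v\<bar> < N"
        unfolding N_def using member_le_sum[OF v, of "\<lambda>v. B v / \<bar>D v\<bar>"] Bnn Suc.prems by simp
      then have "B v < N * \<bar>D v\<bar>" using False by (simp add: field_simps)
      with close Nnn show ?thesis
        by (cases "D v > 0") (auto simp: sgn_if abs_if split: if_splits)
    qed
    then show ?thesis unfolding D_def by blast
  qed
qed

abbreviation real_vec :: "int vec \<Rightarrow> real vec" where
  "real_vec \<equiv> map_vec real_of_int"

lemma real_half_space_imp_int_half_space:
  assumes u: "u \<in> carrier_vec l" "u \<noteq> 0\<^sub>v l"
    and V: "finite V" "V \<subseteq> carrier_vec l" and nonneg: "\<And>v. v \<in> V \<Longrightarrow> 0 \<le> u \<bullet> real_vec v"
  shows "\<exists>c\<in>carrier_vec l. c \<noteq> 0\<^sub>v l \<and> (\<forall>v\<in>V. 0 \<le> v \<bullet> c)"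
proof -
  obtain k where k: "k < l" "u $ k \<noteq> 0"
    using u by (metis carrier_vecD eq_vecI index_zero_vec)
  \<comment> \<open>The coordinate form \<open>k\<close>, which does not vanish at \<open>u\<close>, is included to keep \<open>c\<close> nonzero.\<close>
  define F :: "(nat \<Rightarrow> int) set" where "F = insert (\<lambda>i. of_bool (i = k)) (($) ` V)"
  have "finite F" using V(1) by (simp add: F_def)
  then obtain c :: "nat \<Rightarrow> int" where c: "\<And>v. v \<in> F \<Longrightarrow>
      sgn (\<Sum>i<l. real_of_int (v i) * real_of_int (c i)) = sgn (\<Sum>i<l. real_of_int (v i) * u $ i)"
    using real_vector_signs_realised_by_int_vector[of "{..<l}" F "\<lambda>i. u $ i"] by auto
  have "sgn (real_of_int (c k)) = sgn (u $ k)"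
    using c[of "\<lambda>i. of_bool (i = k)"] k by (simp add: F_def of_bool_def if_distrib[of real_of_int] if_distrib[of "\<lambda>x. x * _"] cong: if_cong)
  then have ck: "c k \<noteq> 0" using k by (auto simp: sgn_if split: if_splits)
  have "0 \<le> v \<bullet> vec l c" if v: "v \<in> V" for v
  proof -
    have vl: "v \<in> carrier_vec l" using V v by blast
    have "u \<bullet> real_vec v = (\<Sum>i<l. real_of_int (v $ i) * u $ i)"
      using vl by (simp add: scalar_prod_def lessThan_atLeast0 mult.commute)
    moreover have "real_of_int (v \<bullet> vec l c) = (\<Sum>i<l. real_of_int (v $ i) * real_of_int (c i))"
      using vl by (simp add: scalar_prod_def lessThan_atLeast0)
    ultimately have "sgn (real_of_int (v \<bullet> vec l c)) = sgn (u \<bullet> real_vec v)"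
      using c[of "($) v"] v by (simp add: F_def)
    then show ?thesis
      using nonneg[OF v] by (auto simp: sgn_if split: if_splits)
  qed
  moreover have "vec l c \<noteq> 0\<^sub>v l"
    using ck k by (metis index_vec index_zero_vec(1))
  ultimately show ?thesis by (intro bexI[of _ "vec l c"]) auto
qed

section \<open>Exponents of a given degree\<close>

definition exponents ::
    "nat \<Rightarrow> nat \<Rightarrow> nat \<Rightarrow> nat \<Rightarrow> (nat \<Rightarrow> nat) \<Rightarrow> int mat \<Rightarrow> (nat \<Rightarrow> int) \<Rightarrow> int vec set" where
  "exponents r n p t d L a =
     {\<nu> \<in> carrier_vec n. (\<forall>i<r. 0 \<le> \<nu> $ i) \<and> deg p t d L \<nu> = a}"

lemma deg_zero:
  assumes "L \<in> carrier_mat (p + t) n"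
  shows "deg p t d L (0\<^sub>v n) = \<one>\<^bsub>char_group p t d\<^esub>"
proof -
  have "(L *\<^sub>v 0\<^sub>v n) $ j = 0" if "j < p + t" for j
    using assms that by (simp add: scalar_prod_def)
  then show ?thesis
    by (auto simp: deg_def char_group_def intro!: restrict_ext)
qed

lemma deg_eq_iff_diff_in_kernel:
  assumes L: "L \<in> carrier_mat (p + t) n" and \<nu>: "\<nu> \<in> carrier_vec n" "\<nu>' \<in> carrier_vec n"
  shows "deg p t d L \<nu> = deg p t d L \<nu>' \<longleftrightarrow> \<nu> - \<nu>' \<in> deg_kernel n p t d L"
proof -
  have comp: "(L *\<^sub>v (\<nu> - \<nu>')) $ j = (L *\<^sub>v \<nu>) $ j - (L *\<^sub>v \<nu>') $ j" if "j < p + t" for j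
  proof -
    have "row L j \<in> carrier_vec n" using L that by auto
    then show ?thesis
      using L \<nu> that by (simp add: scalar_prod_minus_distrib[of _ n])
  qed
  have "deg p t d L \<nu> = deg p t d L \<nu>' \<longleftrightarrow>
      (\<forall>j<p + t. if j < p then (L *\<^sub>v \<nu>) $ j = (L *\<^sub>v \<nu>') $ j
                 else (L *\<^sub>v \<nu>) $ j mod int (d (j - p)) = (L *\<^sub>v \<nu>') $ j mod int (d (j - p)))"
    unfolding deg_def by (auto simp: fun_eq_iff restrict_def)
  also have "\<dots> \<longleftrightarrow>
      (\<forall>j<p + t. if j < p then (L *\<^sub>v (\<nu> - \<nu>')) $ j = 0
                 else (L *\<^sub>v (\<nu> - \<nu>')) $ j mod int (d (j - p)) = 0)"
    by (intro all_cong) (auto simp: comp mod_eq_dvd_iff mod_eq_0_iff_dvd)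
  also have "\<dots> \<longleftrightarrow> deg p t d L (\<nu> - \<nu>') = \<one>\<^bsub>char_group p t d\<^esub>"
    unfolding deg_def char_group_def one_product_group by (auto simp: fun_eq_iff restrict_def)
  finally show ?thesis
    using \<nu> by (simp add: deg_kernel_def)
qed

lemma deg_kernel_add:
  assumes L: "L \<in> carrier_mat (p + t) n"
    and "\<mu> \<in> deg_kernel n p t d L" "\<nu> \<in> carrier_vec n"
  shows "deg p t d L (\<nu> + \<mu>) = deg p t d L \<nu>"
proof -
  have "\<mu> \<in> carrier_vec n" using assms by (simp add: deg_kernel_def)
  moreover from this have "(\<nu> + \<mu>) - \<nu> = \<mu>" using assms(3) by (intro eq_vecI) auto
  ultimately show ?thesis using deg_eq_iff_diff_in_kernel[OF L, of "\<nu> + \<mu>" \<nu>] assms by simp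
qed

text \<open>The difference of the two comparable exponents of Dickson's lemma has degree zero.\<close>

lemma infinite_exponents_imp_kernel_vector:
  assumes L: "L \<in> carrier_mat (p + t) n" and rn: "r \<le> n"
    and inf: "infinite (exponents r n p t d L a)"
  shows "\<exists>\<mu>\<in>deg_kernel n p t d L. \<mu> \<noteq> 0\<^sub>v n \<and> (\<forall>i<r. 0 \<le> \<mu> $ i)"
proof -
  obtain \<nu> \<nu>' where \<nu>: "\<nu> \<in> exponents r n p t d L a" "\<nu>' \<in> exponents r n p t d L a" "\<nu> \<noteq> \<nu>'"
    and le: "\<And>i. i < r \<Longrightarrow> \<nu> $ i \<le> \<nu>' $ i"
    using infinite_exponent_set_has_comparable_pair[OF inf, of r] by (auto simp: exponents_def)
  then have c: "\<nu> \<in> carrier_vec n" "\<nu>' \<in> carrier_vec n" and "deg p t d L \<nu>' = deg p t d L \<nu>"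
    by (auto simp: exponents_def)
  then have "\<nu>' - \<nu> \<in> deg_kernel n p t d L"
    using deg_eq_iff_diff_in_kernel[OF L] by simp
  moreover have "\<nu>' - \<nu> \<noteq> 0\<^sub>v n"
  proof
    assume eq: "\<nu>' - \<nu> = 0\<^sub>v n"
    have "\<nu>' $ i = \<nu> $ i" if "i < n" for i
      using arg_cong[OF eq, of "\<lambda>w. w $ i"] c that by simp
    then show False using \<open>\<nu> \<noteq> \<nu>'\<close> c by (metis carrier_vecD eq_vecI)
  qed
  moreover have "0 \<le> (\<nu>' - \<nu>) $ i" if "i < r" for i
    using le[OF that] c that rn by simp
  ultimately show ?thesis by blast
qed

text \<open>Adding multiples of \<open>\<mu>\<close> to one exponent stays within its degree and never leaves the region of
  nonnegative first \<open>r\<close> entries, and \<open>\<mu> \<noteq> 0\<close> makes all these exponents different.\<close>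

lemma kernel_vector_imp_infinite_exponents:
  assumes L: "L \<in> carrier_mat (p + t) n" and rn: "r \<le> n"
    and \<mu>: "\<mu> \<in> deg_kernel n p t d L" "\<mu> \<noteq> 0\<^sub>v n" "\<And>i. i < r \<Longrightarrow> 0 \<le> \<mu> $ i"
    and ne: "exponents r n p t d L a \<noteq> {}"
  shows "infinite (exponents r n p t d L a)"
proof -
  obtain \<nu> where \<nu>: "\<nu> \<in> exponents r n p t d L a" using ne by blast
  have c: "\<nu> \<in> carrier_vec n" "\<mu> \<in> carrier_vec n"
    using \<nu> \<mu> by (auto simp: exponents_def deg_kernel_def)
  define f where "f k = \<nu> + int k \<cdot>\<^sub>v \<mu>" for k
  have f: "f k \<in> exponents r n p t d L a" for k
  proof (induction k)
    case 0
    have "f 0 = \<nu>" using c by (intro eq_vecI) (auto simp: f_def)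
    then show ?case using \<nu> by simp
  next
    case (Suc k)
    have "f (Suc k) = f k + \<mu>"
      using c by (intro eq_vecI) (auto simp: f_def algebra_simps)
    then show ?case
      using Suc deg_kernel_add[OF L \<mu>(1)] \<mu>(3) c rn by (auto simp: exponents_def)
  qed
  obtain i where i: "i < n" "\<mu> $ i \<noteq> 0"
    using \<mu>(2) c by (metis carrier_vecD eq_vecI index_zero_vec)
  have "inj f"
  proof (rule injI)
    fix k k' assume "f k = f k'"
    then have "f k $ i = f k' $ i" by simp
    then show "k = k'" using i c by (simp add: f_def)
  qed
  then show ?thesis
    using f by (meson finite_subset image_subset_iff range_inj_infinite)
qed

lemma mat_mult_in_deg_kernel:
  assumes L: "L \<in> carrier_mat (p + t) n" and K: "K \<in> carrier_mat n l"
    and cols: "set (cols K) \<subseteq> deg_kernel n p t d L" and c: "c \<in> carrier_vec l"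
  shows "K *\<^sub>v c \<in> deg_kernel n p t d L"
proof -
  have col: "if j < p then row L j \<bullet> col K i = 0 else int (d (j - p)) dvd row L j \<bullet> col K i"
    if "i < l" "j < p + t" for i j
  proof -
    have "col K i \<in> deg_kernel n p t d L"
      using cols K that by (metis carrier_matD(2) cols_length cols_nth nth_mem subset_iff)
    then have "deg p t d L (col K i) j = \<one>\<^bsub>char_group p t d\<^esub> j"
      by (simp add: deg_kernel_def)
    then show ?thesis using that L by (auto simp: deg_def char_group_def split: if_splits)
  qed
  have entry: "(L *\<^sub>v (K *\<^sub>v c)) $ j = (\<Sum>i<l. (row L j \<bullet> col K i) * c $ i)" if "j < p + t" for j
  proof -
    define M where "M = L * K"
    have M: "M \<in> carrier_mat (p + t) l" using L K by (simp add: M_def)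
    have "(L *\<^sub>v (K *\<^sub>v c)) $ j = (M *\<^sub>v c) $ j"
      unfolding M_def assoc_mult_mat_vec[OF L K c] ..
    also have "\<dots> = (\<Sum>i<l. M $$ (j, i) * c $ i)"
      using M c that by (simp add: scalar_prod_def lessThan_atLeast0)
    also have "\<dots> = (\<Sum>i<l. (row L j \<bullet> col K i) * c $ i)"
      using L K that by (intro sum.cong) (auto simp: M_def)
    finally show ?thesis .
  qed
  have "(L *\<^sub>v (K *\<^sub>v c)) $ j = 0" if "j < p" for j
    using entry[of j] col[of _ j] that by simp
  moreover have "int (d (j - p)) dvd (L *\<^sub>v (K *\<^sub>v c)) $ j" if "j < p + t" "\<not> j < p" for j
    using entry[of j] col[of _ j] that by (auto intro!: dvd_sum)
  moreover have "K *\<^sub>v c \<in> carrier_vec n" using K c by simp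
  ultimately show ?thesis
    unfolding deg_kernel_def deg_def char_group_def one_product_group
    by (auto intro!: restrict_ext)
qed

text \<open>The columns of \<open>K\<close> being a basis of the kernel, \<open>c \<mapsto> K c\<close> is a bijection from the integral vectors onto
  the kernel, under which entry \<open>i\<close> of a kernel vector becomes the pairing of \<open>c\<close> with row \<open>i\<close> of \<open>K\<close>.\<close>

lemma kernel_vector_iff_coordinates:
  assumes L: "L \<in> carrier_mat (p + t) n" and K: "K \<in> carrier_mat n l" and rn: "r \<le> n"
    and basis: "columns_form_basis K (deg_kernel n p t d L)"
  shows "(\<exists>\<mu>\<in>deg_kernel n p t d L. \<mu> \<noteq> 0\<^sub>v n \<and> (\<forall>i<r. 0 \<le> \<mu> $ i)) \<longleftrightarrow>
         (\<exists>c\<in>carrier_vec l. c \<noteq> 0\<^sub>v l \<and> (\<forall>i<r. 0 \<le> row K i \<bullet> c))"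
proof -
  have cols: "set (cols K) \<subseteq> deg_kernel n p t d L"
    and coord: "\<And>\<nu>. \<nu> \<in> deg_kernel n p t d L \<Longrightarrow> \<exists>!c. c \<in> carrier_vec l \<and> K *\<^sub>v c = \<nu>"
    using basis K by (auto simp: columns_form_basis_def)
  have ker: "K *\<^sub>v c \<in> deg_kernel n p t d L" if "c \<in> carrier_vec l" for c
    using mat_mult_in_deg_kernel[OF L K cols that] .
  have K0: "K *\<^sub>v 0\<^sub>v l = 0\<^sub>v n" using K by auto
  have inj: "K *\<^sub>v c = 0\<^sub>v n \<longleftrightarrow> c = 0\<^sub>v l" if "c \<in> carrier_vec l" for c
    using coord[OF ker[of "0\<^sub>v l"]] K0 that by (metis zero_carrier_vec)
  have entry: "(K *\<^sub>v c) $ i = row K i \<bullet> c" if "i < r" for c i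
    using K that rn by simp
  show ?thesis
  proof
    assume "\<exists>\<mu>\<in>deg_kernel n p t d L. \<mu> \<noteq> 0\<^sub>v n \<and> (\<forall>i<r. 0 \<le> \<mu> $ i)"
    then show "\<exists>c\<in>carrier_vec l. c \<noteq> 0\<^sub>v l \<and> (\<forall>i<r. 0 \<le> row K i \<bullet> c)"
      using coord inj entry by metis
  next
    assume "\<exists>c\<in>carrier_vec l. c \<noteq> 0\<^sub>v l \<and> (\<forall>i<r. 0 \<le> row K i \<bullet> c)"
    then show "\<exists>\<mu>\<in>deg_kernel n p t d L. \<mu> \<noteq> 0\<^sub>v n \<and> (\<forall>i<r. 0 \<le> \<mu> $ i)"
      using ker inj entry by metis
  qed
qed

section \<open>Monomials span the graded parts freely\<close>

definition exponent_map :: "int vec \<Rightarrow> (nat \<Rightarrow>\<^sub>0 int)" where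
  "exponent_map \<nu> = (\<Sum>i<dim_vec \<nu>. Poly_Mapping.single i (\<nu> $ i))"

lemma lookup_exponent_map:
  "Poly_Mapping.lookup (exponent_map \<nu>) i = (if i < dim_vec \<nu> then \<nu> $ i else 0)"
  by (simp add: exponent_map_def lookup_sum lookup_single when_def sum.delta)

lemma laurent_monom_eq_single: "laurent_monom \<nu> = Poly_Mapping.single (exponent_map \<nu>) 1"
  by (simp add: laurent_monom_def exponent_map_def)

lemma inj_on_exponent_map: "inj_on exponent_map (carrier_vec n)"
proof (rule inj_onI)
  fix \<nu> \<nu>' :: "int vec"
  assume c: "\<nu> \<in> carrier_vec n" "\<nu>' \<in> carrier_vec n" and eq: "exponent_map \<nu> = exponent_map \<nu>'"
  have "\<nu> $ i = \<nu>' $ i" if "i < n" for i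
    using arg_cong[OF eq, of "\<lambda>e. Poly_Mapping.lookup e i"] c that
    by (simp add: lookup_exponent_map)
  then show "\<nu> = \<nu>'" using c by (intro eq_vecI) auto
qed

lemma laurent_monom_in_mixed_laurent_ring_iff:
  assumes "\<nu> \<in> carrier_vec (r + s)"
  shows "(laurent_monom \<nu> :: 'k::field laurent) \<in> mixed_laurent_ring r s \<longleftrightarrow> (\<forall>i<r. 0 \<le> \<nu> $ i)"
proof -
  have "Poly_Mapping.keys (exponent_map \<nu>) \<subseteq> {..<r + s}"
    using assms by (auto simp: in_keys_iff lookup_exponent_map split: if_splits)
  then show ?thesis
    using assms by (auto simp: laurent_monom_eq_single mixed_laurent_ring_def lookup_exponent_map)
qed

lemma graded_part_eq_span_exponents:
  "(graded_part r s p t d L a :: 'k::field laurent set) =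
     Modules.module.span scalar_mult (laurent_monom ` exponents r (r + s) p t d L a)"
proof -
  have "{laurent_monom \<nu> | \<nu>. \<nu> \<in> carrier_vec (r + s) \<and>
          (laurent_monom \<nu> :: 'k laurent) \<in> mixed_laurent_ring r s \<and> deg p t d L \<nu> = a}
      = (laurent_monom ` exponents r (r + s) p t d L a :: 'k laurent set)"
    using laurent_monom_in_mixed_laurent_ring_iff[of _ r s, where ?'k = 'k]
    by (auto simp: exponents_def)
  then show ?thesis unfolding graded_part_def by simp
qed

lemma lookup_scalar_mult:
  "Poly_Mapping.lookup (scalar_mult c f) e = c * Poly_Mapping.lookup f e"
  by (simp add: Poly_Mapping.map.rep_eq when_def)

lemma vector_space_scalar_mult: "vector_space (scalar_mult :: 'k::field \<Rightarrow> 'k laurent \<Rightarrow> 'k laurent)"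
  by unfold_locales
     (auto intro!: poly_mapping_eqI simp: lookup_scalar_mult lookup_add algebra_simps)

text \<open>A monomial is no linear combination of others since its own coefficient vanishes in all of these.\<close>

lemma laurent_monoms_independent:
  assumes "E \<subseteq> carrier_vec n"
  shows "inj_on (laurent_monom :: int vec \<Rightarrow> 'k::field laurent) E"
    and "\<not> Modules.module.dependent scalar_mult (laurent_monom ` E :: 'k laurent set)"
proof -
  interpret laurent: vector_space "scalar_mult :: 'k \<Rightarrow> 'k laurent \<Rightarrow> 'k laurent"
    by (rule vector_space_scalar_mult)
  have coeff: "Poly_Mapping.lookup (laurent_monom \<nu>' :: 'k laurent) (exponent_map \<nu>) = (if \<nu> = \<nu>' then 1 else 0)"
    if "\<nu> \<in> E" "\<nu>' \<in> E" for \<nu> \<nu>'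
  proof -
    have "exponent_map \<nu>' = exponent_map \<nu> \<longleftrightarrow> \<nu>' = \<nu>"
      by (rule inj_on_eq_iff[OF inj_on_exponent_map[of n]]) (use that assms in auto)
    then show ?thesis by (auto simp: laurent_monom_eq_single lookup_single when_def)
  qed
  show "inj_on (laurent_monom :: int vec \<Rightarrow> 'k laurent) E"
    by (rule inj_onI) (metis coeff zero_neq_one)
  show "\<not> laurent.dependent (laurent_monom ` E :: 'k laurent set)"
  proof
    assume "laurent.dependent (laurent_monom ` E :: 'k laurent set)"
    then obtain \<nu> where \<nu>: "\<nu> \<in> E"
      and sp: "laurent_monom \<nu> \<in> laurent.span (laurent_monom ` E - {laurent_monom \<nu>})"
      unfolding laurent.dependent_def by auto
    let ?Z = "{f :: 'k laurent. Poly_Mapping.lookup f (exponent_map \<nu>) = 0}"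
    have "laurent.subspace ?Z"
      by (auto intro!: laurent.subspaceI simp: lookup_add lookup_scalar_mult)
    moreover have "laurent_monom ` E - {laurent_monom \<nu>} \<subseteq> ?Z"
      using coeff[OF \<nu>] by auto
    ultimately have "laurent_monom \<nu> \<in> ?Z"
      using sp laurent.span_minimal by blast
    then show False using coeff[OF \<nu> \<nu>] by simp
  qed
qed

lemma finite_dimensional_graded_part_iff:
  "finite_dimensional (graded_part r s p t d L a :: 'k::field laurent set) \<longleftrightarrow>
     finite (exponents r (r + s) p t d L a)"
proof -
  interpret laurent: vector_space "scalar_mult :: 'k \<Rightarrow> 'k laurent \<Rightarrow> 'k laurent"
    by (rule vector_space_scalar_mult)
  let ?E = "exponents r (r + s) p t d L a"
  have E: "?E \<subseteq> carrier_vec (r + s)" by (auto simp: exponents_def)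
  show ?thesis
  proof
    assume "finite ?E"
    then show "finite_dimensional (graded_part r s p t d L a :: 'k laurent set)"
      unfolding finite_dimensional_def graded_part_eq_span_exponents by blast
  next
    assume "finite_dimensional (graded_part r s p t d L a :: 'k laurent set)"
    then obtain B where B: "finite B" "laurent.span (laurent_monom ` ?E) = laurent.span B"
      unfolding finite_dimensional_def graded_part_eq_span_exponents by blast
    have "laurent_monom ` ?E \<subseteq> laurent.span B"
      unfolding B(2)[symmetric] by (rule laurent.span_superset)
    from laurent.independent_span_bound[OF B(1) laurent_monoms_independent(2)[OF E] this]
    have "finite (laurent_monom ` ?E :: 'k laurent set)" ..
    then show "finite ?E"
      using laurent_monoms_independent(1)[OF E] by (rule finite_imageD)
  qed
qed

lemma graded_part_nonzero_iff:
  "(graded_part r s p t d L a :: 'k::field laurent set) \<noteq> {0} \<longleftrightarrow> exponents r (r + s) p t d L a \<noteq> {}"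
proof -
  interpret laurent: vector_space "scalar_mult :: 'k \<Rightarrow> 'k laurent \<Rightarrow> 'k laurent"
    by (rule vector_space_scalar_mult)
  have "(laurent_monom \<nu> :: 'k laurent) \<noteq> 0" for \<nu>
    unfolding laurent_monom_eq_single by (metis lookup_single_eq lookup_zero zero_neq_one)
  then show ?thesis
    unfolding graded_part_eq_span_exponents
    by (metis (no_types, lifting) all_not_in_conv empty_is_image image_eqI laurent.span_base laurent.span_empty singletonD)
qed

section \<open>The fan of rays\<close>

lemma zero_in_ray: "v \<in> carrier_vec l \<Longrightarrow> 0\<^sub>v l \<in> ray v"
  unfolding ray_def by (auto intro!: exI[of _ 0])

lemma self_in_ray: "v \<in> ray v"
  unfolding ray_def by (auto intro!: exI[of _ 1])

lemma ray_zero: "ray (0\<^sub>v l) = {0\<^sub>v l}"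
proof -
  have "c \<cdot>\<^sub>v 0\<^sub>v l = (0\<^sub>v l :: real vec)" for c by (intro eq_vecI) auto
  then show ?thesis unfolding ray_def by auto
qed

lemma ray_eq_zero_cone_iff:
  assumes "v \<in> carrier_vec l"
  shows "ray v = {0\<^sub>v l} \<longleftrightarrow> v = 0\<^sub>v l"
  using self_in_ray[of v] ray_zero[of l] by auto

lemma ray_subset_carrier: "v \<in> carrier_vec l \<Longrightarrow> ray v \<subseteq> carrier_vec l"
  by (auto simp: ray_def)

lemma cone_dim_ray:
  assumes v: "v \<in> carrier_vec l"
  shows "cone_dim l (ray v) = (if v = 0\<^sub>v l then 0 else 1)"
proof -
  interpret vec_space "TYPE(real)" l .
  show ?thesis
  proof (cases "v = 0\<^sub>v l")
    case True
    then have "span (ray v) = span {}"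
      using span_zero span_empty by (simp add: ray_zero)
    then show ?thesis
      using True dim_zero_vs unfolding cone_dim_def by simp
  next
    case False
    have "ray v \<subseteq> span {v}"
      using v span_self[OF v[folded carrier_vec_def]]
      by (auto simp: ray_def intro!: smult_in_span)
    then have "span (ray v) \<subseteq> span {v}"
      using v by (intro span_subsetI) auto
    moreover have "span {v} \<subseteq> span (ray v)"
      by (rule span_is_monotone) (simp add: self_in_ray)
    ultimately have sp: "span (ray v) = span {v}" by blast
    have "lin_indpt {}"
      by (metis empty_subsetI fin_dim finite_basis_exists subset_li_is_li vec_vs vectorspace.basis_def)
    then have "lin_indpt {v}"
      using lin_dep_iff_in_span[of "{}" v] v False span_empty by auto
    then have "maximal {v} (\<lambda>T. T \<subseteq> {v} \<and> lin_indpt T)"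
      by (auto simp: maximal_def)
    then have "vectorspace.dim class_ring (span_vs {v}) = 1"
      using dim_span[of "{v}" "{v}"] v by simp
    then show ?thesis
      using False unfolding cone_dim_def sp by simp
  qed
qed

lemma scalar_prod_self_pos:
  fixes v :: "real vec"
  assumes v: "v \<in> carrier_vec l" and "v \<noteq> 0\<^sub>v l"
  shows "0 < v \<bullet> v"
proof -
  obtain i where i: "i < l" "v $ i \<noteq> 0"
    using assms by (metis carrier_vecD eq_vecI index_zero_vec)
  have "0 < (\<Sum>j = 0..<l. v $ j * v $ j)"
    by (rule sum_pos2[of _ i]) (use i in \<open>auto simp: zero_less_mult_iff less_le\<close>)
  then show ?thesis using v by (simp add: scalar_prod_def)
qed

lemma rational_polyhedral_cone_ray:
  assumes v: "v \<in> carrier_vec l"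
  shows "rational_polyhedral_cone l (ray (real_vec v))"
proof -
  define G where "G = mat_of_cols l [v]"
  have G: "G \<in> carrier_mat l 1" 
    using mat_of_cols_carrier(1)[of l "[v]"] by (simp add: G_def)
  have mult: "map_mat real_of_int G *\<^sub>v c = c $ 0 \<cdot>\<^sub>v real_vec v" if "c \<in> carrier_vec 1" for c
    using that v by (intro eq_vecI) (auto simp: G_def scalar_prod_def mat_of_cols_index)
  have "ray (real_vec v) = {map_mat real_of_int G *\<^sub>v c | c. c \<in> carrier_vec 1 \<and> (\<forall>j<1. 0 \<le> c $ j)}"
  proof (intro equalityI subsetI)
    fix x assume "x \<in> ray (real_vec v)"
    then obtain a where a: "0 \<le> a" "x = a \<cdot>\<^sub>v real_vec v" by (auto simp: ray_def)
    then have "x = map_mat real_of_int G *\<^sub>v vec 1 (\<lambda>_. a)" by (subst mult) auto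
    then show "x \<in> {map_mat real_of_int G *\<^sub>v c | c. c \<in> carrier_vec 1 \<and> (\<forall>j<1. 0 \<le> c $ j)}"
      using a(1) by (auto intro!: exI[of _ "vec 1 (\<lambda>_. a)"])
  next
    fix x assume "x \<in> {map_mat real_of_int G *\<^sub>v c | c. c \<in> carrier_vec 1 \<and> (\<forall>j<1. 0 \<le> c $ j)}"
    then show "x \<in> ray (real_vec v)" using mult by (auto simp: ray_def)
  qed
  then show ?thesis
    unfolding rational_polyhedral_cone_def using G by blast
qed

lemma strongly_convex_ray:
  assumes v: "v \<in> carrier_vec l"
  shows "strongly_convex l (ray v)"
proof -
  have zero: "- 0\<^sub>v l = (0\<^sub>v l :: real vec)" by auto
  have "x = 0\<^sub>v l" if "x \<in> ray v" "- x \<in> ray v" for x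
  proof -
    obtain a b where ab: "0 \<le> a" "x = a \<cdot>\<^sub>v v" "0 \<le> b" "- x = b \<cdot>\<^sub>v v"
      using \<open>x \<in> ray v\<close> \<open>- x \<in> ray v\<close> by (auto simp: ray_def)
    have "x $ i = 0" if i: "i < l" for i
    proof -
      have "- (a * v $ i) = b * v $ i"
        using arg_cong[OF ab(4), of "\<lambda>w. w $ i"] ab(2) v i by simp
      then have "(a + b) * v $ i = 0" by (simp add: algebra_simps)
      then show ?thesis using ab v i by (auto simp: add_nonneg_eq_0_iff)
    qed
    then show ?thesis using ab v by (intro eq_vecI) auto
  qed
  moreover have "- x \<in> ray v" if "x \<in> uminus ` ray v" for x
    using that ray_subset_carrier[OF v] by (auto simp: subset_iff)
  ultimately have "ray v \<inter> uminus ` ray v \<subseteq> {0\<^sub>v l}" by blast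
  moreover have "0\<^sub>v l \<in> ray v \<inter> uminus ` ray v"
    using imageI[OF zero_in_ray[OF v], of uminus] zero_in_ray[OF v] zero by simp
  ultimately show ?thesis
    unfolding strongly_convex_def by blast
qed

lemma cone_face_refl:
  assumes "\<sigma> \<subseteq> carrier_vec l"
  shows "cone_face l \<sigma> \<sigma>"
  unfolding cone_face_def
  by (rule bexI[of _ "0\<^sub>v l"]) (use assms in \<open>auto simp: subset_iff\<close>)

lemma ray_inter_hyperplane:
  assumes v: "v \<in> carrier_vec l" and u: "u \<in> carrier_vec l" and uv: "u \<bullet> v \<noteq> 0"
  shows "{x \<in> ray v. u \<bullet> x = 0} = {0\<^sub>v l}"
proof (intro equalityI subsetI)
  fix x assume "x \<in> {x \<in> ray v. u \<bullet> x = 0}"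
  then show "x \<in> {0\<^sub>v l}" using u v uv by (auto simp: ray_def)
next
  fix x assume "x \<in> {0\<^sub>v l :: real vec}"
  then show "x \<in> {x \<in> ray v. u \<bullet> x = 0}" using zero_in_ray[OF v] u by auto
qed

lemma zero_cone_face_of_ray:
  assumes v: "v \<in> carrier_vec l"
  shows "cone_face l {0\<^sub>v l} (ray v)"
proof (cases "v = 0\<^sub>v l")
  case True
  then show ?thesis using cone_face_refl[of "{0\<^sub>v l}" l] by (simp add: ray_zero)
next
  case False
  have "{0\<^sub>v l} = {x \<in> ray v. v \<bullet> x = 0}"
    using ray_inter_hyperplane[OF v v] scalar_prod_self_pos[OF v False] by simp
  moreover have "\<forall>x\<in>ray v. 0 \<le> v \<bullet> x"
    using v scalar_prod_self_pos[OF v False] by (auto simp: ray_def)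
  ultimately show ?thesis unfolding cone_face_def using v by blast
qed

lemma cone_face_ray_cases:
  assumes v: "v \<in> carrier_vec l" and face: "cone_face l \<tau> (ray v)"
  shows "\<tau> = ray v \<or> \<tau> = {0\<^sub>v l}"
proof -
  obtain u where u: "u \<in> carrier_vec l" and \<tau>: "\<tau> = {x \<in> ray v. u \<bullet> x = 0}"
    using face by (auto simp: cone_face_def)
  show ?thesis
  proof (cases "u \<bullet> v = 0")
    case True
    then have "\<tau> = ray v" using \<tau> u v by (auto simp: ray_def)
    then show ?thesis ..
  next
    case False
    then show ?thesis using ray_inter_hyperplane[OF v u] \<tau> by simp
  qed
qed

lemma ray_inter_cases:
  assumes v: "v \<in> carrier_vec l" and w: "w \<in> carrier_vec l"
  shows "ray v = ray w \<or> ray v \<inter> ray w = {0\<^sub>v l}"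
proof (rule disjCI)
  assume "ray v \<inter> ray w \<noteq> {0\<^sub>v l}"
  then obtain x where x: "x \<in> ray v" "x \<in> ray w" "x \<noteq> 0\<^sub>v l"
    using zero_in_ray[OF v] zero_in_ray[OF w] by blast
  have same: "ray x = ray y" if y: "y \<in> carrier_vec l" and xy: "x \<in> ray y" for y
  proof -
    obtain a where a: "0 \<le> a" "x = a \<cdot>\<^sub>v y" using xy by (auto simp: ray_def)
    moreover have "a \<noteq> 0" using a(2) x(3) y by auto
    ultimately have pos: "0 < a" by simp
    show ?thesis
    proof (intro equalityI subsetI)
      fix z assume "z \<in> ray x"
      then obtain b where "0 \<le> b" "z = (b * a) \<cdot>\<^sub>v y"
        using a by (auto simp: ray_def smult_smult_assoc)
      then show "z \<in> ray y" using pos unfolding ray_def by fastforce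
    next
      fix z assume "z \<in> ray y"
      then obtain b where b: "0 \<le> b" "z = b \<cdot>\<^sub>v y" by (auto simp: ray_def)
      then have "z = (b / a) \<cdot>\<^sub>v x" using pos a by (simp add: smult_smult_assoc)
      moreover have "0 \<le> b / a" using b pos by simp
      ultimately show "z \<in> ray x" unfolding ray_def by blast
    qed
  qed
  show "ray v = ray w" using same[OF v x(1)] same[OF w x(2)] by simp
qed

text \<open>The faces of a ray are itself and the zero cone, and different rays meet only in 0.  A zero vector in
  \<open>W\<close> contributes the zero cone, so all cones of this fan have the same form.\<close>

lemma fan_of_rays:
  assumes W: "finite W" "W \<subseteq> carrier_vec l" "0\<^sub>v l \<in> W"
  shows "fan l ((\<lambda>v. ray (real_vec v)) ` W)"
proof -
  let ?\<Delta> = "(\<lambda>v. ray (real_vec v)) ` W"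
  have carr: "real_vec v \<in> carrier_vec l" if "v \<in> W" for v using W that by auto
  have "real_vec (0\<^sub>v l) = 0\<^sub>v l" by auto
  then have zero: "{0\<^sub>v l} \<in> ?\<Delta>"
    using W(3) ray_zero[of l] by (metis image_eqI)
  have faces: "\<tau> \<in> ?\<Delta>" if "v \<in> W" "cone_face l \<tau> (ray (real_vec v))" for v \<tau>
    using cone_face_ray_cases[OF carr that(2)] that(1) zero by auto
  have inter: "cone_face l (ray (real_vec v) \<inter> ray (real_vec w)) (ray (real_vec v))"
    if "v \<in> W" "w \<in> W" for v w
    using ray_inter_cases[OF carr carr, of v w] that zero_cone_face_of_ray[OF carr]
      cone_face_refl[OF ray_subset_carrier[OF carr]] by auto
  show ?thesis
    unfolding fan_def
  proof (intro conjI ballI allI impI)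
    show "finite ?\<Delta>" using W(1) by simp
  next
    fix \<sigma> assume "\<sigma> \<in> ?\<Delta>"
    then show "rational_polyhedral_cone l \<sigma>" "strongly_convex l \<sigma>"
      using W(2) rational_polyhedral_cone_ray strongly_convex_ray[OF carr] by auto
  next
    fix \<sigma> \<tau> assume "\<sigma> \<in> ?\<Delta>" "cone_face l \<tau> \<sigma>"
    then show "\<tau> \<in> ?\<Delta>" using faces by blast
  next
    fix \<sigma> \<sigma>' assume "\<sigma> \<in> ?\<Delta>" "\<sigma>' \<in> ?\<Delta>"
    then show "cone_face l (\<sigma> \<inter> \<sigma>') \<sigma>" "cone_face l (\<sigma> \<inter> \<sigma>') \<sigma>'"
      using inter by (auto simp: Int_commute)
  qed
qed

lemma compatible_fan_of_rays:
  assumes K: "K \<in> carrier_mat n l"  and rn: "r \<le> n"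
  shows "compatible_fan r l K ((\<lambda>v. ray (real_vec v)) ` insert (0\<^sub>v l) (row K ` {..<r}))"
proof -
  have carr: "real_vec (row K i) \<in> carrier_vec l" if "i < r" for i using K rn that by auto
  have z: "real_vec (0\<^sub>v l) = 0\<^sub>v l" by auto
  have "cone_dim l (ray (0\<^sub>v l)) = 0" by (simp add: cone_dim_ray)
  moreover have "cone_dim l (ray (real_vec (row K i))) = 1 \<longleftrightarrow> ray (real_vec (row K i)) \<noteq> {0\<^sub>v l}"
    if "i < r" for i
    using cone_dim_ray[OF carr[OF that]] ray_eq_zero_cone_iff[OF carr[OF that]] by simp
  ultimately show ?thesis
    unfolding compatible_fan_def by (auto simp: z)
qed

section \<open>Equivalence of the three conditions\<close>

text \<open>A half-space containing some compatible fan contains in particular its rays, so it also contains the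
  smallest compatible fan, which has no cones besides these rays and the zero cone.\<close>

lemma compatible_fan_in_half_space_iff:
  assumes K: "K \<in> carrier_mat n l" and rn: "r \<le> n"
  shows "(\<exists>\<Delta>. fan l \<Delta> \<and> compatible_fan r l K \<Delta> \<and> contained_in_half_space l \<Delta>) \<longleftrightarrow>
         (\<exists>c\<in>carrier_vec l. c \<noteq> 0\<^sub>v l \<and> (\<forall>i<r. 0 \<le> row K i \<bullet> c))"
proof -
  have rows: "row K ` {..<r} \<subseteq> carrier_vec l" using K rn by auto
  show ?thesis
  proof
    assume "\<exists>\<Delta>. fan l \<Delta> \<and> compatible_fan r l K \<Delta> \<and> contained_in_half_space l \<Delta>"
    then obtain \<Delta> u where comp: "compatible_fan r l K \<Delta>"
      and u: "u \<in> carrier_vec l" "u \<noteq> 0\<^sub>v l" "\<And>\<sigma> v. \<sigma> \<in> \<Delta> \<Longrightarrow> v \<in> \<sigma> \<Longrightarrow> 0 \<le> u \<bullet> v"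
      unfolding contained_in_half_space_def by blast
    have nonneg: "0 \<le> u \<bullet> real_vec (row K i)" if i: "i < r" for i
    proof (cases "real_vec (row K i) = 0\<^sub>v l")
      case True
      show ?thesis unfolding True using u(1) by simp
    next
      case False
      have "real_vec (row K i) \<in> carrier_vec l" using rows i by auto
      then have "ray (real_vec (row K i)) \<noteq> {0\<^sub>v l}"
        using False ray_eq_zero_cone_iff by simp
      then have "ray (real_vec (row K i)) \<in> {\<sigma> \<in> \<Delta>. cone_dim l \<sigma> = 1}"
        unfolding comp[unfolded compatible_fan_def] using i by auto
      then have "ray (real_vec (row K i)) \<in> \<Delta>" by simp
      then show ?thesis using u(3) self_in_ray by blast
    qed
    have "\<exists>c\<in>carrier_vec l. c \<noteq> 0\<^sub>v l \<and> (\<forall>v\<in>row K ` {..<r}. 0 \<le> v \<bullet> c)"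
      by (rule real_half_space_imp_int_half_space[OF u(1,2) _ rows]) (use nonneg in auto)
    then show "\<exists>c\<in>carrier_vec l. c \<noteq> 0\<^sub>v l \<and> (\<forall>i<r. 0 \<le> row K i \<bullet> c)"
      by auto
  next
    assume "\<exists>c\<in>carrier_vec l. c \<noteq> 0\<^sub>v l \<and> (\<forall>i<r. 0 \<le> row K i \<bullet> c)"
    then obtain c where c: "c \<in> carrier_vec l" "c \<noteq> 0\<^sub>v l" "\<And>i. i < r \<Longrightarrow> 0 \<le> row K i \<bullet> c"
      by blast
    let ?W = "insert (0\<^sub>v l) (row K ` {..<r})"
    have prod: "real_vec c \<bullet> (a \<cdot>\<^sub>v real_vec w) = a * real_of_int (w \<bullet> c)" if "w \<in> carrier_vec l" for w a
    proof -
      have "real_vec c \<bullet> (a \<cdot>\<^sub>v real_vec w) = a * (real_vec c \<bullet> real_vec w)"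
        using c(1) that by (intro scalar_prod_smult_distrib) auto
      also have "real_vec c \<bullet> real_vec w = (\<Sum>i = 0..<l. real_of_int (c $ i) * real_of_int (w $ i))"
        using c(1) that by (simp add: scalar_prod_def)
      also have "\<dots> = real_of_int (c \<bullet> w)"
        using that by (simp add: scalar_prod_def)
      also have "c \<bullet> w = w \<bullet> c"
        using c(1) that by (intro comm_scalar_prod) auto
      finally show ?thesis .
    qed
    have pos: "0 \<le> w \<bullet> c" if "w \<in> ?W" for w using that c by auto
    have "0 \<le> real_vec c \<bullet> x" if w: "w \<in> ?W" and x: "x \<in> ray (real_vec w)" for w x
    proof -
      obtain a where a: "0 \<le> a" "x = a \<cdot>\<^sub>v real_vec w" using x by (auto simp: ray_def)
      have "w \<in> carrier_vec l" using w rows by auto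
      then show ?thesis using a pos[OF w] by (simp add: prod)
    qed
    moreover have "real_vec c \<noteq> 0\<^sub>v l"
    proof
      assume eq: "real_vec c = 0\<^sub>v l"
      have "c $ i = 0" if "i < l" for i
        using arg_cong[OF eq, of "\<lambda>w. w $ i"] c(1) that by simp
      then show False using c(1,2) by (metis carrier_vecD eq_vecI index_zero_vec)
    qed
    ultimately have "contained_in_half_space l ((\<lambda>v. ray (real_vec v)) ` ?W)"
      unfolding contained_in_half_space_def using c(1) by (intro bexI[of _ "real_vec c"]) auto
    moreover have "fan l ((\<lambda>v. ray (real_vec v)) ` ?W)"
      using rows by (intro fan_of_rays) auto
    ultimately show "\<exists>\<Delta>. fan l \<Delta> \<and> compatible_fan r l K \<Delta> \<and> contained_in_half_space l \<Delta>"
      using compatible_fan_of_rays[OF K rn] by blast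
  qed
qed

theorem theorem8p2:
  fixes r s p t n l :: nat and d :: "nat \<Rightarrow> nat" and L K :: "int mat"
  assumes n: "n = r + s"
    and d: "\<And>j. j < t \<Longrightarrow> 0 < d j"
    and L: "L \<in> carrier_mat (p + t) n"
    and faithful: "faithful_action (diag_group p t d :: (nat \<Rightarrow> 'k::{alg_closed_field, field_char_0}) monoid)
                     (affine_torus_space r s) (diag_action r s L)"
    and l: "l = n - p"
    and K: "K \<in> carrier_mat n l"
    and basis: "columns_form_basis K (deg_kernel n p t d L)"
  shows "((\<exists>a\<in>carrier (char_group p t d).
             (graded_part r s p t d L a :: 'k laurent set) \<noteq> {0} \<and>
             finite_dimensional (graded_part r s p t d L a :: 'k laurent set))
          \<longleftrightarrow>
          (\<forall>a\<in>carrier (char_group p t d).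
             finite_dimensional (graded_part r s p t d L a :: 'k laurent set)))
       \<and>
         ((\<forall>a\<in>carrier (char_group p t d).
             finite_dimensional (graded_part r s p t d L a :: 'k laurent set))
          \<longleftrightarrow>
          (\<forall>\<Delta>. fan l \<Delta> \<and> compatible_fan r l K \<Delta> \<longrightarrow> \<not> contained_in_half_space l \<Delta>))"
proof -
  have rn: "r \<le> n" using n by simp
  let ?E = "exponents r n p t d L"
  let ?F = "\<exists>\<mu>\<in>deg_kernel n p t d L. \<mu> \<noteq> 0\<^sub>v n \<and> (\<forall>i<r. 0 \<le> \<mu> $ i)"
  have fd: "finite_dimensional (graded_part r s p t d L a :: 'k laurent set) \<longleftrightarrow> finite (?E a)"
    and nz: "(graded_part r s p t d L a :: 'k laurent set) \<noteq> {0} \<longleftrightarrow> ?E a \<noteq> {}" for a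
    unfolding n by (rule finite_dimensional_graded_part_iff, rule graded_part_nonzero_iff)
  have fin: "finite (?E a)" if "\<not> ?F" for a
    using infinite_exponents_imp_kernel_vector[OF L rn] that by blast
  have inf: "infinite (?E a)" if "?F" "?E a \<noteq> {}" for a
    using kernel_vector_imp_infinite_exponents[OF L rn] that by blast
  let ?e = "\<one>\<^bsub>char_group p t d\<^esub>"
  have "?e = deg p t d L (0\<^sub>v n)" using deg_zero[OF L] by simp
  then have e: "?E ?e \<noteq> {}" using rn by (auto simp: exponents_def intro!: exI[of _ "0\<^sub>v n"])
  have "group (char_group p t d)" unfolding char_group_def by (intro product_group) auto
  then have "?e \<in> carrier (char_group p t d)" by (simp add: group.is_monoid monoid.one_closed)
  then have one: "(\<exists>a\<in>carrier (char_group p t d). ?E a \<noteq> {} \<and> finite (?E a)) \<longleftrightarrow> \<not> ?F"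
    and two: "(\<forall>a\<in>carrier (char_group p t d). finite (?E a)) \<longleftrightarrow> \<not> ?F"
    using fin inf e by blast+
  have "(\<forall>\<Delta>. fan l \<Delta> \<and> compatible_fan r l K \<Delta> \<longrightarrow> \<not> contained_in_half_space l \<Delta>) \<longleftrightarrow> \<not> ?F"
    using compatible_fan_in_half_space_iff[OF K rn] kernel_vector_iff_coordinates[OF L K rn basis]
    by blast
  with one two show ?thesis unfolding fd nz by blast
qed

end
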